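(* Let $k$ be a field, $\mathfrak{g}$ a nonzero Lie algebra over $k$, $V$ a $k$-vector space and $\Omega(\mathfrak{g}, V) = (\triangleleft, \triangleright, f, \{-,-\})$ an extending datum of $\mathfrak{g}$ through $V$. The following statements are equivalent: (1) $\mathfrak{g} \,\natural\, V$ is a unified product (i.e. the vector space $\mathfrak{g}\times V$ with the bracket associated to $\Omega(\mathfrak{g},V)$ is a Lie algebra); (2) The following compatibilities hold for all $g, h \in \mathfrak{g}$ and $x, y, z \in V$: (LE1) $f(x, x) = 0$ and $\{x, x\} = 0$; (LE2) $(V, \triangleleft)$ is a right $\mathfrak{g}$-module; (LE3) $x \triangleright [g, h] = [x \triangleright g, h] + [g, x \triangleright h] + (x \triangleleft g) \triangleright h - (x \triangleleft h) \triangleright g$; (LE4) $\{x, y\} \triangleleft g = \{x, y \triangleleft g\} + \{x \triangleleft g, y\} + x \triangleleft (y \triangleright g) - y \triangleleft (x \triangleright g)$; (LE5) $\{x, y\} \triangleright g = x \triangleright (y \triangleright g) - y \triangleright (x \triangleright g) + [g, f(x, y)] + f(x, y \triangleleft g) + f(x \triangleleft g, y)$; (LE6) $f(x, \{y, z\}) + f(y, \{z, x\}) + f(z, \{x, y\}) + x \triangleright f(y, z) + y \triangleright f(z, x) + z \triangleright f(x, y) = 0$; (LE7) $\{x, \{y, z\}\} + \{y, \{z, x\}\} + \{z, \{x, y\}\} + x \triangleleft f(y, z) + y \triangleleft f(z, x) + z \triangleleft f(x, y) = 0$.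
   Context: All vector spaces, Lie algebras, linear and bilinear maps are over an arbitrary field $k$. A Lie algebra is a vector space with a bilinear bracket satisfying $[g,g]=0$ and the Jacobi identity. An extending datum of a Lie algebra $\mathfrak{g}$ through a vector space $V$ is a system $\Omega(\mathfrak{g}, V) = (\triangleleft, \triangleright, f, \{-,-\})$ of four bilinear maps $\triangleleft : V \times \mathfrak{g} \to V$, $\triangleright : V \times \mathfrak{g} \to \mathfrak{g}$, $f : V\times V \to \mathfrak{g}$, $\{-,-\} : V\times V \to V$. Denote by $\mathfrak{g} \,\natural\, V$ the vector space $\mathfrak{g}\times V$ with the bilinear map $$[(g, x), (h, y)] := \bigl([g, h] + x \triangleright h - y\triangleright g + f(x, y),\ \{x, y\} + x\triangleleft h - y\triangleleft g\bigr)$$ for $g,h\in\mathfrak{g}$, $x,y\in V$. It is called the unified product of $\mathfrak{g}$ and $\Omega(\mathfrak{g},V)$ if it is a Lie algebra with this bracket. A right $\mathfrak{g}$-module is a vector space $V$ with a bilinear map $\triangleleft: V\times\mathfrak{g}\to V$ such that $x \triangleleft [g, h] = (x \triangleleft g) \triangleleft h - (x \triangleleft h) \triangleleft g$ for all $x\in V$, $g,h\in\mathfrak{g}$. *)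

theory Defs
  imports "HOL-Analysis.Product_Vector"
begin

text \<open>
  As in the locale \<^locale>\<open>vector_space\<close>, a \<open>k\<close>-vector space is an additive abelian group type
  together with a scalar multiplication by the field \<open>'k\<close>.
\<close>

definition bilinear_map ::
    "('k::field \<Rightarrow> 'a::ab_group_add \<Rightarrow> 'a) \<Rightarrow> ('k \<Rightarrow> 'b::ab_group_add \<Rightarrow> 'b) \<Rightarrow>
     ('k \<Rightarrow> 'c::ab_group_add \<Rightarrow> 'c) \<Rightarrow> ('a \<Rightarrow> 'b \<Rightarrow> 'c) \<Rightarrow> bool"
  where "bilinear_map s1 s2 s3 B \<longleftrightarrow>
    (\<forall>a. Vector_Spaces.linear s2 s3 (\<lambda>b. B a b)) \<and>
    (\<forall>b. Vector_Spaces.linear s1 s3 (\<lambda>a. B a b))"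

locale lie_algebra = vector_space scale
  for scale :: "'k::field \<Rightarrow> 'g::ab_group_add \<Rightarrow> 'g" +
  fixes bracket :: "'g \<Rightarrow> 'g \<Rightarrow> 'g"
  assumes bilinear: "bilinear_map scale scale scale bracket"
    and alternating: "bracket a a = 0"
    and jacobi: "bracket a (bracket b c) + bracket b (bracket c a) + bracket c (bracket a b) = 0"

locale right_lie_module =
  lie_algebra scaleG bracket + V: vector_space scaleV
  for scaleG :: "'k::field \<Rightarrow> 'g::ab_group_add \<Rightarrow> 'g"
    and bracket :: "'g \<Rightarrow> 'g \<Rightarrow> 'g"
    and scaleV :: "'k \<Rightarrow> 'v::ab_group_add \<Rightarrow> 'v" +
  fixes act :: "'v \<Rightarrow> 'g \<Rightarrow> 'v"
  assumes act_bilinear: "bilinear_map scaleV scaleG scaleV act"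
    and act_bracket: "act x (bracket g h) = act (act x g) h - act (act x h) g"

text \<open>
  The arguments \<open>ra\<close>, \<open>la\<close>, \<open>f\<close>, \<open>br\<close> stand for the four maps
  \<open>\<triangleleft>\<close>, \<open>\<triangleright>\<close>, \<open>f\<close>, \<open>{-,-}\<close>, in this order.
\<close>

definition extending_datum ::
    "('k::field \<Rightarrow> 'g::ab_group_add \<Rightarrow> 'g) \<Rightarrow> ('k \<Rightarrow> 'v::ab_group_add \<Rightarrow> 'v) \<Rightarrow>
     ('v \<Rightarrow> 'g \<Rightarrow> 'v) \<Rightarrow> ('v \<Rightarrow> 'g \<Rightarrow> 'g) \<Rightarrow> ('v \<Rightarrow> 'v \<Rightarrow> 'g) \<Rightarrow> ('v \<Rightarrow> 'v \<Rightarrow> 'v) \<Rightarrow> bool"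
  where "extending_datum sG sV ra la f br \<longleftrightarrow>
    bilinear_map sV sG sV ra \<and> bilinear_map sV sG sG la \<and>
    bilinear_map sV sV sG f \<and> bilinear_map sV sV sV br"

definition unified_product_bracket ::
    "('g::ab_group_add \<Rightarrow> 'g \<Rightarrow> 'g) \<Rightarrow> ('v::ab_group_add \<Rightarrow> 'g \<Rightarrow> 'v) \<Rightarrow> ('v \<Rightarrow> 'g \<Rightarrow> 'g) \<Rightarrow>
     ('v \<Rightarrow> 'v \<Rightarrow> 'g) \<Rightarrow> ('v \<Rightarrow> 'v \<Rightarrow> 'v) \<Rightarrow> 'g \<times> 'v \<Rightarrow> 'g \<times> 'v \<Rightarrow> 'g \<times> 'v"
  where "unified_product_bracket brG ra la f br = (\<lambda>(g, x) (h, y).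
    (brG g h + la x h - la y g + f x y, br x y + ra x h - ra y g))"

definition is_unified_product ::
    "('k::field \<Rightarrow> 'g::ab_group_add \<Rightarrow> 'g) \<Rightarrow> ('g \<Rightarrow> 'g \<Rightarrow> 'g) \<Rightarrow>
     ('k \<Rightarrow> 'v::ab_group_add \<Rightarrow> 'v) \<Rightarrow> ('v \<Rightarrow> 'g \<Rightarrow> 'v) \<Rightarrow> ('v \<Rightarrow> 'g \<Rightarrow> 'g) \<Rightarrow>
     ('v \<Rightarrow> 'v \<Rightarrow> 'g) \<Rightarrow> ('v \<Rightarrow> 'v \<Rightarrow> 'v) \<Rightarrow> bool"
  where "is_unified_product sG brG sV ra la f br \<longleftrightarrow>
    lie_algebra (module_prod.scale sG sV) (unified_product_bracket brG ra la f br)"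

end

theory Submission
  imports Defs
begin

text \<open>
  The bracket \<open>B\<close> of the unified product is bilinear because its constituents are, so only
  alternation and the Jacobi identity are at stake.

  On a pair \<open>(g, x)\<close> the four action terms of \<open>B (g, x) (g, x)\<close> cancel and \<open>brG g g\<close> vanishes,
  which leaves \<open>(f x x, br x x)\<close>. Hence \<open>B\<close> is alternating exactly when \<open>f\<close> and \<open>br\<close> are.

  The Jacobiator is additive in each argument, and every pair is the sum of one vector from
  \<open>\<gg>\<close> and one from \<open>V\<close>. It is also invariant under cyclic rotation, so its eight homogeneous
  components reduce to the four types \<open>\<gg>\<gg>\<gg>\<close>, \<open>\<gg>\<gg>V\<close>, \<open>\<gg>VV\<close>, \<open>VVV\<close>
  (lemma \<open>jacobiator_zero_iff\<close>). Once \<open>f\<close> and \<open>br\<close> are alternating, each type is a pair of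
  identities, one in \<open>\<gg>\<close> and one in \<open>V\<close>. The type \<open>\<gg>\<gg>\<gg>\<close> is the Jacobi identity of \<open>\<gg>\<close>.
  The type \<open>\<gg>\<gg>V\<close> gives the formula for \<open>x \<triangleright> [g, h]\<close> and the module law for \<open>x \<triangleleft> [g, h]\<close>; the
  type \<open>\<gg>VV\<close> gives the formulas for \<open>{x, y} \<triangleright> g\<close> and \<open>{x, y} \<triangleleft> g\<close>; and the type \<open>VVV\<close> gives
  the two cyclic identities.
\<close>

lemma bilinear_map_iff:
  "bilinear_map s1 s2 s3 B \<longleftrightarrow>
     vector_space s1 \<and> vector_space s2 \<and> vector_space s3 \<and>
     (\<forall>a b c. B (a + b) c = B a c + B b c) \<and> (\<forall>a b c. B a (b + c) = B a b + B a c) \<and>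
     (\<forall>r a b. B (s1 r a) b = s3 r (B a b)) \<and> (\<forall>r a b. B a (s2 r b) = s3 r (B a b))"
  unfolding bilinear_map_def Vector_Spaces.linear_iff by blast

locale biadditive =
  fixes B :: "'a::ab_group_add \<Rightarrow> 'b::ab_group_add \<Rightarrow> 'c::ab_group_add"
  assumes add_left: "B (a + a') b = B a b + B a' b"
    and add_right: "B a (b + b') = B a b + B a b'"
begin

sublocale left: additive "\<lambda>a. B a b" for b
  by unfold_locales (rule add_left)

sublocale right: additive "B a" for a
  by unfold_locales (rule add_right)

lemmas expand = add_left add_right left.zero right.zero left.minus right.minus left.diff right.diff

end

lemma bilinear_map_biadditive: "bilinear_map s1 s2 s3 B \<Longrightarrow> biadditive B"
  unfolding bilinear_map_iff biadditive_def by blast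

text \<open>Polarisation. Nothing is divided by 2, so the argument is valid in every characteristic.\<close>

lemma alternating_antisym:
  assumes "biadditive B" and alt: "\<And>a. B a a = 0"
  shows "B b a = - B a b"
proof -
  interpret biadditive B by fact
  have "0 = B (a + b) (a + b)" by (simp add: alt)
  also have "\<dots> = (B a a + B a b) + (B b a + B b b)"
    by (simp only: add_left add_right add_ac)
  also have "\<dots> = B a b + B b a" by (simp add: alt)
  finally show ?thesis by (metis add.commute eq_neg_iff_add_eq_0)
qed

definition jacobiator :: "('a::ab_group_add \<Rightarrow> 'a \<Rightarrow> 'a) \<Rightarrow> 'a \<Rightarrow> 'a \<Rightarrow> 'a \<Rightarrow> 'a"
  where "jacobiator B a b c = B a (B b c) + B b (B c a) + B c (B a b)"

lemma jacobiator_rotate: "jacobiator B a b c = jacobiator B b c a"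
  by (simp add: jacobiator_def algebra_simps)

lemma jacobiator_add_left:
  assumes "biadditive B"
  shows "jacobiator B (a + a') b c = jacobiator B a b c + jacobiator B a' b c"
proof -
  interpret biadditive B by fact
  show ?thesis by (simp add: jacobiator_def expand algebra_simps)
qed

text \<open>
  Rotation carries additivity from the first argument to the other two. It also reduces the six
  mixed components to two, since the three positions of a single argument from \<open>V\<close>, or of a
  single argument from \<open>\<gg>\<close>, lie in one cyclic orbit.
\<close>

lemma jacobiator_zero_iff:
  fixes B :: "'g::ab_group_add \<times> 'v::ab_group_add \<Rightarrow> 'g \<times> 'v \<Rightarrow> 'g \<times> 'v"
  assumes B: "biadditive B"
  shows "(\<forall>u v w. jacobiator B u v w = 0) \<longleftrightarrow>
    (\<forall>g h k. jacobiator B (g, 0) (h, 0) (k, 0) = 0) \<and>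
    (\<forall>g h x. jacobiator B (g, 0) (h, 0) (0, x) = 0) \<and>
    (\<forall>g x y. jacobiator B (g, 0) (0, x) (0, y) = 0) \<and>
    (\<forall>x y z. jacobiator B (0, x) (0, y) (0, z) = 0)"
    (is "?all \<longleftrightarrow> ?types")
proof
  assume types: ?types
  have split_left: "jacobiator B u v w
      = jacobiator B (fst u, 0) v w + jacobiator B (0, snd u) v w" for u v w
    using jacobiator_add_left[OF B, of "(fst u, 0)" "(0, snd u)" v w] by simp
  have split_middle: "jacobiator B u v w
      = jacobiator B u (fst v, 0) w + jacobiator B u (0, snd v) w" for u v w
    by (metis split_left jacobiator_rotate)
  have split_right: "jacobiator B u v w
      = jacobiator B u v (fst w, 0) + jacobiator B u v (0, snd w)" for u v w
    by (metis split_left jacobiator_rotate)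
  have mixed: "jacobiator B (g, 0) (0, x) (h, 0) = 0" "jacobiator B (0, x) (g, 0) (h, 0) = 0"
    "jacobiator B (0, x) (g, 0) (0, y) = 0" "jacobiator B (0, x) (0, y) (g, 0) = 0" for g h x y
    using types by (metis jacobiator_rotate)+
  show ?all
  proof (intro allI)
    fix u v w
    show "jacobiator B u v w = 0"
      by (subst split_left, subst (1 2) split_middle, subst (1 2 3 4) split_right)
        (simp add: types mixed)
  qed
qed simp

locale lie_extending_datum =
  lie_algebra sG brG + V: vector_space sV
  for sG :: "'k::field \<Rightarrow> 'g::ab_group_add \<Rightarrow> 'g"
    and brG :: "'g \<Rightarrow> 'g \<Rightarrow> 'g"
    and sV :: "'k \<Rightarrow> 'v::ab_group_add \<Rightarrow> 'v" +
  fixes ra :: "'v \<Rightarrow> 'g \<Rightarrow> 'v"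
    and la :: "'v \<Rightarrow> 'g \<Rightarrow> 'g"
    and f :: "'v \<Rightarrow> 'v \<Rightarrow> 'g"
    and br :: "'v \<Rightarrow> 'v \<Rightarrow> 'v"
  assumes datum: "extending_datum sG sV ra la f br"
begin

lemma datum_bilinear:
  "bilinear_map sV sG sV ra" "bilinear_map sV sG sG la"
  "bilinear_map sV sV sG f" "bilinear_map sV sV sV br"
  using datum by (auto simp: extending_datum_def)

sublocale brG: biadditive brG using bilinear by (rule bilinear_map_biadditive)
sublocale ra: biadditive ra using datum_bilinear(1) by (rule bilinear_map_biadditive)
sublocale la: biadditive la using datum_bilinear(2) by (rule bilinear_map_biadditive)
sublocale f: biadditive f using datum_bilinear(3) by (rule bilinear_map_biadditive)
sublocale br: biadditive br using datum_bilinear(4) by (rule bilinear_map_biadditive)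

lemmas expand = brG.expand ra.expand la.expand f.expand br.expand

sublocale prod: vector_space_prod sG sV ..

abbreviation B :: "'g \<times> 'v \<Rightarrow> 'g \<times> 'v \<Rightarrow> 'g \<times> 'v"
  where "B \<equiv> unified_product_bracket brG ra la f br"

lemma B_apply: "B (g, x) (h, y) =
    (brG g h + la x h - la y g + f x y, br x y + ra x h - ra y g)"
  by (simp add: unified_product_bracket_def)

lemma bilinear_B: "bilinear_map prod.scale prod.scale prod.scale B"
proof -
  have "vector_space prod.scale" ..
  moreover have "B (u + v) w = B u w + B v w" "B u (v + w) = B u v + B u w" for u v w
    by (cases u; cases v; cases w; simp add: B_apply expand algebra_simps)+
  moreover have "B (prod.scale r u) v = prod.scale r (B u v)"
    "B u (prod.scale r v) = prod.scale r (B u v)" for r u v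
    using bilinear datum_bilinear
    by (cases u; cases v; simp add: B_apply prod.scale_def bilinear_map_iff
        scale_right_distrib scale_right_diff_distrib
        V.scale_right_distrib V.scale_right_diff_distrib)+
  ultimately show ?thesis by (simp add: bilinear_map_iff)
qed

sublocale B: biadditive B using bilinear_B by (rule bilinear_map_biadditive)

lemma is_unified_product_iff:
  "is_unified_product sG brG sV ra la f br \<longleftrightarrow>
    (\<forall>u. B u u = 0) \<and> (\<forall>u v w. jacobiator B u v w = 0)"
  unfolding is_unified_product_def lie_algebra_def lie_algebra_axioms_def jacobiator_def
  using bilinear_B by (auto simp: bilinear_map_iff)

lemma B_alternating_iff: "(\<forall>u. B u u = 0) \<longleftrightarrow> (\<forall>x. f x x = 0 \<and> br x x = 0)"
  by (auto simp: B_apply alternating prod_eq_iff)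

lemma jacobiator_ggg: "jacobiator B (g, 0) (h, 0) (k, 0) = 0"
  by (simp add: jacobiator_def B_apply expand jacobi zero_prod_def)

text \<open>
  In the cyclic sum the bracket \<open>brG h (la x g)\<close> has its arguments in the opposite order to the
  compatibility condition; antisymmetry of \<open>brG\<close> corrects this.
\<close>

lemma jacobiator_ggV:
  "jacobiator B (g, 0) (h, 0) (0, x) = 0 \<longleftrightarrow>
    la x (brG g h) = brG (la x g) h + brG g (la x h) + la (ra x g) h - la (ra x h) g \<and>
    ra x (brG g h) = ra (ra x g) h - ra (ra x h) g"
proof -
  have "brG h (la x g) = - brG (la x g) h"
    using brG.biadditive_axioms alternating by (rule alternating_antisym)
  then have "jacobiator B (g, 0) (h, 0) (0, x) =
    (la x (brG g h) - (brG (la x g) h + brG g (la x h) + la (ra x g) h - la (ra x h) g),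
     ra x (brG g h) - (ra (ra x g) h - ra (ra x h) g))"
    by (simp add: jacobiator_def B_apply expand algebra_simps)
  then show ?thesis by (simp add: zero_prod_def)
qed

text \<open>
  Here the rotated term \<open>B (0, y) (B (g, 0) (0, x))\<close> produces \<open>f y (ra x g)\<close> and
  \<open>br y (ra x g)\<close>; alternation of \<open>f\<close> and \<open>br\<close> is what turns them into the terms
  \<open>f (ra x g) y\<close> and \<open>br (ra x g) y\<close> of the compatibility conditions.
\<close>

lemma jacobiator_gVV:
  assumes f_alt: "\<And>x. f x x = 0" and br_alt: "\<And>x. br x x = 0"
  shows "jacobiator B (g, 0) (0, x) (0, y) = 0 \<longleftrightarrow>
    ra (br x y) g = br x (ra y g) + br (ra x g) y + ra x (la y g) - ra y (la x g) \<and>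
    la (br x y) g = la x (la y g) - la y (la x g) + brG g (f x y) + f x (ra y g) + f (ra x g) y"
proof -
  have "f y (ra x g) = - f (ra x g) y"
    using f.biadditive_axioms f_alt by (rule alternating_antisym)
  moreover have "br y (ra x g) = - br (ra x g) y"
    using br.biadditive_axioms br_alt by (rule alternating_antisym)
  ultimately have "jacobiator B (g, 0) (0, x) (0, y) =
    (la x (la y g) - la y (la x g) + brG g (f x y) + f x (ra y g) + f (ra x g) y - la (br x y) g,
     br x (ra y g) + br (ra x g) y + ra x (la y g) - ra y (la x g) - ra (br x y) g)"
    by (simp add: jacobiator_def B_apply expand algebra_simps)
  then show ?thesis by (auto simp: zero_prod_def)
qed

lemma jacobiator_VVV:
  "jacobiator B (0, x) (0, y) (0, z) = 0 \<longleftrightarrow>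
    f x (br y z) + f y (br z x) + f z (br x y) + la x (f y z) + la y (f z x) + la z (f x y) = 0 \<and>
    br x (br y z) + br y (br z x) + br z (br x y) + ra x (f y z) + ra y (f z x) + ra z (f x y) = 0"
proof -
  have "jacobiator B (0, x) (0, y) (0, z) =
    (f x (br y z) + f y (br z x) + f z (br x y) + la x (f y z) + la y (f z x) + la z (f x y),
     br x (br y z) + br y (br z x) + br z (br x y) + ra x (f y z) + ra y (f z x) + ra z (f x y))"
    by (simp add: jacobiator_def B_apply expand algebra_simps)
  then show ?thesis by (simp add: zero_prod_def)
qed

lemma right_lie_module_iff:
  "right_lie_module sG brG sV ra \<longleftrightarrow>
    (\<forall>g h x. ra x (brG g h) = ra (ra x g) h - ra (ra x h) g)"
  unfolding right_lie_module_def right_lie_module_axioms_def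
  using lie_algebra_axioms V.vector_space_axioms datum_bilinear(1) by blast

end

theorem theorem2p2:
  fixes sG :: "'k::field \<Rightarrow> 'g::ab_group_add \<Rightarrow> 'g"
    and sV :: "'k \<Rightarrow> 'v::ab_group_add \<Rightarrow> 'v"
    and brG :: "'g \<Rightarrow> 'g \<Rightarrow> 'g"  ("\<lbrack>_,/ _\<rbrack>")
    and ra :: "'v \<Rightarrow> 'g \<Rightarrow> 'v"  (infix "\<triangleleft>" 75)
    and la :: "'v \<Rightarrow> 'g \<Rightarrow> 'g"  (infix "\<triangleright>" 75)
    and f :: "'v \<Rightarrow> 'v \<Rightarrow> 'g"
    and br :: "'v \<Rightarrow> 'v \<Rightarrow> 'v"  ("\<lbrace>_,/ _\<rbrace>")
  assumes "lie_algebra sG brG"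
    and "\<exists>g::'g. g \<noteq> 0"
    and "vector_space sV"
    and "extending_datum sG sV ra la f br"
  shows "is_unified_product sG brG sV ra la f br \<longleftrightarrow>
     (\<forall>x. f x x = 0 \<and> \<lbrace>x, x\<rbrace> = 0) \<and>
     right_lie_module sG brG sV ra \<and>
     (\<forall>g h x. x \<triangleright> \<lbrack>g, h\<rbrack> =
        \<lbrack>x \<triangleright> g, h\<rbrack> + \<lbrack>g, x \<triangleright> h\<rbrack> + (x \<triangleleft> g) \<triangleright> h - (x \<triangleleft> h) \<triangleright> g) \<and>
     (\<forall>g x y. \<lbrace>x, y\<rbrace> \<triangleleft> g =
        \<lbrace>x, y \<triangleleft> g\<rbrace> + \<lbrace>x \<triangleleft> g, y\<rbrace> + x \<triangleleft> (y \<triangleright> g) - y \<triangleleft> (x \<triangleright> g)) \<and>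
     (\<forall>g x y. \<lbrace>x, y\<rbrace> \<triangleright> g =
        x \<triangleright> (y \<triangleright> g) - y \<triangleright> (x \<triangleright> g) + \<lbrack>g, f x y\<rbrack> + f x (y \<triangleleft> g) + f (x \<triangleleft> g) y) \<and>
     (\<forall>x y z. f x \<lbrace>y, z\<rbrace> + f y \<lbrace>z, x\<rbrace> + f z \<lbrace>x, y\<rbrace>
        + x \<triangleright> f y z + y \<triangleright> f z x + z \<triangleright> f x y = 0) \<and>
     (\<forall>x y z. \<lbrace>x, \<lbrace>y, z\<rbrace>\<rbrace> + \<lbrace>y, \<lbrace>z, x\<rbrace>\<rbrace> + \<lbrace>z, \<lbrace>x, y\<rbrace>\<rbrace>
        + x \<triangleleft> f y z + y \<triangleleft> f z x + z \<triangleleft> f x y = 0)"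
proof -
  interpret lie_extending_datum sG brG sV ra la f br
    using assms(1,3,4) by (simp add: lie_extending_datum_def lie_extending_datum_axioms_def)
  (* Both sides force f and br to be alternating; rewriting the gVV type into the stated
     identities relies on this. *)
  show ?thesis
  proof (cases "\<forall>x. f x x = 0 \<and> \<lbrace>x, x\<rbrace> = 0")
    case True
    then have f_alt: "\<And>x. f x x = 0" and br_alt: "\<And>x. \<lbrace>x, x\<rbrace> = 0" by auto
    show ?thesis
      unfolding is_unified_product_iff B_alternating_iff jacobiator_zero_iff[OF B.biadditive_axioms]
        right_lie_module_iff jacobiator_ggV jacobiator_gVV[OF f_alt br_alt] jacobiator_VVV
      by (simp add: jacobiator_ggg) blast
  next
    case False
    then show ?thesis
      unfolding is_unified_product_iff B_alternating_iff by blast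
  qed
qed

end
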